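(* Assume that $\theta=(p,\alpha,\beta)$ and $\theta'=(p',\alpha',\beta')$ belong to $$\left\{(p,\alpha,\beta)\in(0,1/2)\times\mathbb{S}^1\times\mathbb{S}^1,\quad \alpha\neq\beta \pmod{2\pi}\right\}$$ and that $f,f'$ belong to $$\left\{f:\mathbb{S}^1\to\mathbb{R}\ \text{density such that, for all } l\in\{1,2,3,4\},\ f^{\star l}\in\mathbb{R}\setminus\{0\}\right\}.$$ Suppose $pf_\alpha+(1-p)f_\beta=p'f'_{\alpha'}+(1-p')f'_{\beta'}$. Then 1. either $(p',\alpha',\beta')=(p,\alpha,\beta)$ and $f'=f$, 2. or $(p',\alpha',\beta')=(p,\alpha+\pi,\beta+\pi)$ and $f'=f_\pi$, 3. or, if $\beta-\alpha=\pi\pmod{2\pi}$, then $f'$ is a linear combination of $f$ and $f_\pi$, and either $(\alpha',\beta')=(\alpha,\beta)$, or $(\alpha',\beta')=(\beta,\alpha)$, 4. or, if $\beta-\alpha=\pm 2\pi/3\pmod{2\pi}$, then $f'$ is a linear combination of $f_{\pi/3}, f_{-\pi/3}, f_\pi$ and $p'=(1-2p)/(2-3p)$ and (a) if $\beta-\alpha=2\pi/3$, $(\alpha',\beta')=(\alpha+\pi,\beta-\pi/3)$ or $(\alpha',\beta')=(\alpha,\beta+2\pi/3)$, (b) if $\beta-\alpha=-2\pi/3$, $(\alpha',\beta')=(\alpha+\pi,\beta+\pi/3)$ or $(\alpha',\beta')=(\alpha,\beta-2\pi/3)$.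
   Context: $\mathbb{S}^1$ is the circle, whose points are identified with angles modulo $2\pi$; functions on $\mathbb{S}^1$ are identified with their $2\pi$-periodized versions on $\mathbb{R}$. A density is a probability density on $\mathbb{S}^1$. For a function $g$ on $\mathbb{S}^1$ and an angle $\alpha$, $g_\alpha(x):=g(x-\alpha)$. For an integrable function $\phi:\mathbb{S}^1\to\mathbb{R}$ and $l\in\mathbb{Z}$, the Fourier coefficient is $\phi^{\star l}=\int_{\mathbb{S}^1}\phi(x)e^{-ilx}\frac{dx}{2\pi}$. The symbol $f'$ denotes another density, not the derivative of $f$.
   Formalization: In item 4, when α'=α, f' is a linear combination of f_{2π/3}, f_{-2π/3}, f instead of the printed f_{π/3}, f_{-π/3}, f_π (false there: l=0 and l=3 coefficients conflict); the printed span is kept when α'=α+π. Equality of densities is almost everywhere. *)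

theory Defs
  imports
    "HOL-Analysis.Analysis"
    "HOL-Library.Periodic_Fun"
    "HOL-Library.Real_Mod"
begin

(* Points of the circle are real angles compared by congruence modulo 2 pi, and functions on the
   circle are 2 pi-periodic functions on the reals. *)

definition rot :: "real \<Rightarrow> (real \<Rightarrow> real) \<Rightarrow> real \<Rightarrow> real" where
  "rot \<alpha> g = (\<lambda>x. g (x - \<alpha>))"

(* Densities are elements of L^1, so they are compared almost everywhere. *)
definition ae_eq :: "(real \<Rightarrow> real) \<Rightarrow> (real \<Rightarrow> real) \<Rightarrow> bool" where
  "ae_eq g h \<longleftrightarrow> (AE x in lborel. g x = h x)"

definition circle_density :: "(real \<Rightarrow> real) \<Rightarrow> bool" where
  "circle_density f \<longleftrightarrow>
     periodic_fun_simple f (2 * pi) \<and>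
     f \<in> borel_measurable borel \<and>
     (\<forall>x. 0 \<le> f x) \<and>
     set_integrable lborel {0..2 * pi} f \<and>
     (LINT x:{0..2 * pi}|lborel. f x) = 1"

definition fourier_coeff :: "(real \<Rightarrow> real) \<Rightarrow> int \<Rightarrow> complex" where
  "fourier_coeff \<phi> l =
     (LINT x:{0..2 * pi}|lborel.
        complex_of_real (\<phi> x) * exp (- (\<i> * of_int l * complex_of_real x))) / (2 * pi)"

definition parameter_set :: "(real \<times> real \<times> real) set" where
  "parameter_set = {(p, \<alpha>, \<beta>). 0 < p \<and> p < 1/2 \<and> \<not> [\<alpha> = \<beta>] (rmod (2 * pi))}"

definition density_class :: "(real \<Rightarrow> real) set" where
  "density_class =
     {f. circle_density f \<and> (\<forall>l\<in>{1, 2, 3, 4}. fourier_coeff f l \<in> \<real> - {0})}"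

definition mixture :: "real \<Rightarrow> real \<Rightarrow> real \<Rightarrow> (real \<Rightarrow> real) \<Rightarrow> real \<Rightarrow> real" where
  "mixture p \<alpha> \<beta> f = (\<lambda>x. p * rot \<alpha> f x + (1 - p) * rot \<beta> f x)"

end

theory Submission
  imports Defs "HOL-Computational_Algebra.Polynomial"
begin

text \<open>Comparing Fourier coefficients of the two mixtures, the complex numbers
  p exp(-il alpha) + (1-p) exp(-il beta) and p' exp(-il alpha') + (1-p') exp(-il beta') are real
  multiples of each other for l = 1, ..., 4. Writing u_1, ..., u_4 for the differences
  alpha' - alpha, beta' - alpha, alpha' - beta, beta' - beta and w_i for the products of the
  corresponding weights, this says that the sum of the w_i sin(l u_i) vanishes. Since
  sin(l u) / sin u is a polynomial of degree l - 1 in cos u, a Vandermonde argument makes the sum of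
  the w_i sin u_i vanish already over every class of indices sharing the same cos u_i; there the
  sines agree up to sign, so signed sums of weights vanish. The ordering of the weights leaves three
  configurations. If all sines vanish then beta = alpha + pi; if u_3 = -u_2 and
  sin u_1 = sin u_4 = 0 then p' = p and both angles move by the same multiple of pi; if
  u_2 = u_3 = -u_4 and sin u_1 = 0 then 3 u_4 is a multiple of pi. The densities are then related by
  inverting the convolution with p' and 1-p' on the group generated by the shift, or, in the second
  configuration, because p h(x - alpha) = -(1-p) h(x - beta) contracts the L1 norm of h.\<close>

section \<open>Integrals of periodic functions\<close>

text \<open>Reduce \<open>t\<close> to \<open>s\<close> in [0, T), cut the period at
  \<open>T - s\<close>, and move the two pieces by \<open>s\<close> and by \<open>s - T\<close>:
  they tile the period again, in the other order. The \<open>has_bochner_integral\<close> form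
  carries integrability and value together, so both can be read off below.\<close>

lemma has_bochner_integral_periodic_shift:
  fixes F :: "real \<Rightarrow> 'a::{banach, second_countable_topology}"
  assumes per: "periodic_fun_simple F T" and T: "0 < T"
    and int: "set_integrable lborel {0..T} F"
  shows "has_bochner_integral lborel (\<lambda>x. indicator {0..T} x *\<^sub>R F (x - t)) (LINT x:{0..T}|lborel. F x)"
proof -
  interpret periodic_fun_simple F T by (fact per)
  \<comment> \<open>Half-open intervals make the two pieces disjoint before and after the move; the
    endpoint 0 is a null set.\<close>
  have ends: "has_bochner_integral lborel (\<lambda>x. indicator {0..T} x *\<^sub>R G x) z \<longleftrightarrow>
      has_bochner_integral lborel (\<lambda>x. indicator {0<..T} x *\<^sub>R G x) z" for G :: "real \<Rightarrow> 'a" and z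
    by (rule has_bochner_integral_discrete_difference[where X="{0}"])
       (auto simp: indicator_def)
  define s where "s = t rmod T"
  have s: "0 \<le> s" "s < T"
    using T by (auto simp: s_def rmod_nonneg rmod_less)
  have "[t = s] (rmod T)" by (simp add: s_def)
  then obtain n :: int where n: "s = t + of_int n * T"
    by (auto simp: rcong_altdef)
  have Fs: "F (x - t) = F (x - s)" for x
    using minus_of_int[of "x - t" n] by (simp add: n algebra_simps)
  let ?A = "{0<..T - s}" and ?B = "{T - s<..T}"
  define a where "a = (LINT x:?A|lborel. F x)"
  define b where "b = (LINT x:?B|lborel. F x)"
  have intA: "set_integrable lborel ?A F" and intB: "set_integrable lborel ?B F"
    using s by (auto intro!: set_integrable_subset[OF int])
  have A: "has_bochner_integral lborel (\<lambda>x. indicator ?A x *\<^sub>R F x) a"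
    and B: "has_bochner_integral lborel (\<lambda>x. indicator ?B x *\<^sub>R F x) b"
    using intA intB unfolding a_def b_def set_integrable_def set_lebesgue_integral_def
    by (auto simp: has_bochner_integral_iff)
  have "has_bochner_integral lborel (\<lambda>x. indicator ?A x *\<^sub>R F x + indicator ?B x *\<^sub>R F x) (a + b)"
    by (intro has_bochner_integral_add A B)
  also have "(\<lambda>x. indicator ?A x *\<^sub>R F x + indicator ?B x *\<^sub>R F x) = (\<lambda>x. indicator {0<..T} x *\<^sub>R F x)"
    using s by (auto simp: indicator_def fun_eq_iff)
  finally have "has_bochner_integral lborel (\<lambda>x. indicator {0..T} x *\<^sub>R F x) (a + b)"
    unfolding ends .
  then have total: "(LINT x:{0..T}|lborel. F x) = a + b"
    by (simp add: set_lebesgue_integral_def has_bochner_integral_integral_eq)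
  have A': "has_bochner_integral lborel (\<lambda>x. indicator ?A (- s + 1 * x) *\<^sub>R F (- s + 1 * x)) a"
    using A by (subst (asm) lborel_has_bochner_integral_real_affine_iff[of 1 _ _ "- s"]) simp_all
  have B': "has_bochner_integral lborel
      (\<lambda>x. indicator ?B (T - s + 1 * x) *\<^sub>R F (T - s + 1 * x)) b"
    using B by (subst (asm) lborel_has_bochner_integral_real_affine_iff[of 1 _ _ "T - s"]) simp_all
  \<comment> \<open>The second piece is moved by \<open>s - T\<close> instead of \<open>s\<close>;
    periodicity makes this the same integrand.\<close>
  have FT: "F (T - s + 1 * x) = F (x - s)" for x
    using plus_1[of "x - s"] by (simp add: algebra_simps)
  have "has_bochner_integral lborel (\<lambda>x. indicator ?A (- s + 1 * x) *\<^sub>R F (- s + 1 * x)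
      + indicator ?B (T - s + 1 * x) *\<^sub>R F (T - s + 1 * x)) (a + b)"
    by (intro has_bochner_integral_add A' B')
  also have "(\<lambda>x. indicator ?A (- s + 1 * x) *\<^sub>R F (- s + 1 * x)
      + indicator ?B (T - s + 1 * x) *\<^sub>R F (T - s + 1 * x)) = (\<lambda>x. indicator {0<..T} x *\<^sub>R F (x - t))"
    unfolding FT Fs using s by (auto simp: indicator_def fun_eq_iff)
  finally show ?thesis
    unfolding total ends .
qed

lemma set_integrable_periodic_shift:
  fixes F :: "real \<Rightarrow> 'a::{banach, second_countable_topology}"
  assumes "periodic_fun_simple F T" "0 < T" "set_integrable lborel {0..T} F"
  shows "set_integrable lborel {0..T} (\<lambda>x. F (x - t))"
  unfolding set_integrable_def using has_bochner_integral_periodic_shift[OF assms] by (rule integrable.intros)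

lemma set_integral_periodic_shift:
  fixes F :: "real \<Rightarrow> 'a::{banach, second_countable_topology}"
  assumes "periodic_fun_simple F T" "0 < T" "set_integrable lborel {0..T} F"
  shows "(LINT x:{0..T}|lborel. F (x - t)) = (LINT x:{0..T}|lborel. F x)"
  using has_bochner_integral_integral_eq[OF has_bochner_integral_periodic_shift[OF assms]]
  by (simp only: set_lebesgue_integral_def)

section \<open>Almost-everywhere statements about periodic functions\<close>

lemma AE_lborel_shift:
  fixes P :: "real \<Rightarrow> bool"
  assumes "AE x in lborel. P x"
  shows "AE x in lborel. P (x - t)"
proof -
  have "AE x in distr lborel borel ((+) (- t)). P x"
    using assms by (simp only: lborel_distr_plus)
  then have "AE x in lborel. P (- t + x)"
    by (rule AE_distrD[rotated]) measurable
  then show ?thesis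
    by (simp add: algebra_simps)
qed

text \<open>Every point has an integer translate in one period, and the countably many translates of
  the exceptional null set still form a null set.\<close>

lemma AE_lborel_periodic:
  fixes P :: "real \<Rightarrow> bool"
  assumes per: "periodic_fun_simple P T" and T: "0 < T"
    and AE: "AE x in lborel. x \<in> {0..T} \<longrightarrow> P x"
  shows "AE x in lborel. P x"
proof -
  interpret periodic_fun_simple P T by (fact per)
  have "AE x in lborel. \<forall>n::int. x - of_int n * T \<in> {0..T} \<longrightarrow> P (x - of_int n * T)"
    unfolding AE_all_countable by (intro allI AE_lborel_shift[OF AE])
  then show ?thesis
  proof eventually_elim
    case (elim x)
    have "[x = x rmod T] (rmod T)" by simp
    then obtain n :: int where n: "x rmod T = x + of_int n * T"
      by (auto simp: rcong_altdef)
    have "x - of_int (- n) * T = x rmod T"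
      by (simp add: n)
    moreover have "x rmod T \<in> {0..T}"
      using T by (auto simp: rmod_nonneg rmod_le)
    ultimately have "P (x - of_int (- n) * T)"
      using elim by metis
    then show ?case
      using minus_of_int[of x "- n"] by simp
  qed
qed

text \<open>Taking absolute values and integrating over one period, where both shifts drop out,
  gives |r| I = |s| I for the L1 norm I of \<open>h\<close>; as |r| < |s|, I vanishes.\<close>

lemma AE_eq_zero_if_contracted:
  fixes h :: "real \<Rightarrow> real"
  assumes per: "periodic_fun_simple h T" and T: "0 < T"
    and int: "set_integrable lborel {0..T} h"
    and r: "\<bar>r\<bar> < \<bar>s\<bar>"
    and eq: "AE x in lborel. r * h (x - a) + s * h (x - b) = 0"
  shows "AE x in lborel. h x = 0"
proof -
  interpret periodic_fun_simple h T by (fact per)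
  let ?H = "\<lambda>x. \<bar>h x\<bar>"
  define I where "I = (LINT x:{0..T}|lborel. ?H x)"
  have per': "periodic_fun_simple ?H T"
    by standard (simp add: plus_period)
  have int': "set_integrable lborel {0..T} ?H"
    using int by (rule set_integrable_abs)
  note shift = set_integral_periodic_shift[OF per' T int']
  have "(LINT x:{0..T}|lborel. \<bar>r\<bar> * ?H (x - a)) = (LINT x:{0..T}|lborel. \<bar>s\<bar> * ?H (x - b))"
  proof -
    have ae: "AE x in lborel. \<bar>r\<bar> * ?H (x - a) = \<bar>s\<bar> * ?H (x - b)"
      using eq
    proof eventually_elim
      case (elim x)
      then have "r * h (x - a) = - (s * h (x - b))" by simp
      then show ?case by (metis abs_minus_cancel abs_mult)
    qed
    have "set_integrable lborel {0..T} (\<lambda>x. \<bar>r\<bar> * ?H (x - a))"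
      "set_integrable lborel {0..T} (\<lambda>x. \<bar>s\<bar> * ?H (x - b))"
      by (intro set_integrable_mult_right set_integrable_periodic_shift[OF per' T int'])+
    then show ?thesis
      unfolding set_lebesgue_integral_def set_integrable_def
      using ae by (intro integral_cong_AE) (auto dest: borel_measurable_integrable)
  qed
  then have "\<bar>r\<bar> * I = \<bar>s\<bar> * I"
    by (simp add: shift I_def)
  then have "I = 0"
    using r by simp
  then have "AE x in lborel. indicator {0..T} x *\<^sub>R ?H x = 0"
    using int' unfolding I_def set_lebesgue_integral_def set_integrable_def
    by (subst (asm) integral_nonneg_eq_0_iff_AE) auto
  then have "AE x in lborel. x \<in> {0..T} \<longrightarrow> h x = 0"
    by eventually_elim (auto simp: indicator_def split: if_splits)
  moreover have "periodic_fun_simple (\<lambda>x. h x = 0) T"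
    by standard (simp add: plus_period)
  ultimately show ?thesis
    using T by (rule AE_lborel_periodic[rotated 2])
qed

section \<open>Fourier coefficients of mixtures\<close>

lemma set_integrable_mult_exp:
  fixes \<phi> :: "real \<Rightarrow> real"
  assumes "set_integrable lborel A \<phi>"
  shows "set_integrable lborel A (\<lambda>x. complex_of_real (\<phi> x) * exp (- (\<i> * of_int l * complex_of_real x)))"
proof -
  have [measurable]: "(\<lambda>x. exp (- (\<i> * of_int l * complex_of_real x))) \<in> borel_measurable borel"
    by (intro borel_measurable_continuous_onI continuous_intros)
  have [measurable]: "(\<lambda>x. indicator A x *\<^sub>R \<phi> x) \<in> borel_measurable lborel"
    using assms unfolding set_integrable_def by (rule borel_measurable_integrable)
  have "(\<lambda>x. complex_of_real (indicator A x *\<^sub>R \<phi> x) * exp (- (\<i> * of_int l * complex_of_real x)))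
      \<in> borel_measurable lborel"
    by measurable
  then show ?thesis
    unfolding set_integrable_def
    by (intro Bochner_Integration.integrable_bound[OF assms[unfolded set_integrable_def]])
       (simp_all add: norm_mult scaleR_conv_of_real mult.assoc)
qed

lemma fourier_coeff_rot:
  assumes per: "periodic_fun_simple \<phi> (2 * pi)"
    and int: "set_integrable lborel {0..2 * pi} \<phi>"
  shows "fourier_coeff (rot a \<phi>) l = cis (- of_int l * a) * fourier_coeff \<phi> l"
proof -
  interpret periodic_fun_simple \<phi> "2 * pi" by (fact per)
  let ?F = "\<lambda>x. complex_of_real (\<phi> x) * exp (- (\<i> * of_int l * complex_of_real x))"
  have per': "periodic_fun_simple ?F (2 * pi)"
  proof
    fix x
    have "exp (- (\<i> * of_int l * complex_of_real (x + 2 * pi))) =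
        exp (- (\<i> * of_int l * complex_of_real x) + of_int (- l) * (of_real (2 * pi) * \<i>))"
      by (simp add: algebra_simps)
    also have "\<dots> = exp (- (\<i> * of_int l * complex_of_real x))"
      by (simp add: exp_eq) (rule exI[of _ "- l"], simp)
    finally show "?F (x + 2 * pi) = ?F x"
      by (simp only: plus_period)
  qed
  have "complex_of_real (rot a \<phi> x) * exp (- (\<i> * of_int l * complex_of_real x)) =
      cis (- of_int l * a) * ?F (x - a)" for x
    by (simp add: rot_def cis_conv_exp exp_add [symmetric] exp_diff exp_minus field_simps)
  then have "fourier_coeff (rot a \<phi>) l =
      (LINT x:{0..2 * pi}|lborel. cis (- of_int l * a) * ?F (x - a)) / (2 * pi)"
    unfolding fourier_coeff_def by (simp only:)
  also have "\<dots> = cis (- of_int l * a) * (LINT x:{0..2 * pi}|lborel. ?F (x - a)) / (2 * pi)"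
    by (simp only: set_integral_mult_right)
  also have "(LINT x:{0..2 * pi}|lborel. ?F (x - a)) = (LINT x:{0..2 * pi}|lborel. ?F x)"
    by (rule set_integral_periodic_shift[OF per' _ set_integrable_mult_exp[OF int]]) simp
  finally show ?thesis
    by (simp only: fourier_coeff_def times_divide_eq_right)
qed

lemma fourier_coeff_linear_combination:
  assumes "set_integrable lborel {0..2 * pi} g" "set_integrable lborel {0..2 * pi} h"
  shows "fourier_coeff (\<lambda>x. r * g x + s * h x) l = of_real r * fourier_coeff g l + of_real s * fourier_coeff h l"
proof -
  note int = set_integrable_mult_exp[OF assms(1), of l] set_integrable_mult_exp[OF assms(2), of l]
  let ?E = "\<lambda>x. exp (- (\<i> * of_int l * complex_of_real x))"
  have "(LINT x:{0..2 * pi}|lborel. complex_of_real (r * g x + s * h x) * ?E x) =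
      (LINT x:{0..2 * pi}|lborel. of_real r * (of_real (g x) * ?E x) + of_real s * (of_real (h x) * ?E x))"
    by (simp add: algebra_simps)
  also have "\<dots> = of_real r * (LINT x:{0..2 * pi}|lborel. of_real (g x) * ?E x)
      + of_real s * (LINT x:{0..2 * pi}|lborel. of_real (h x) * ?E x)"
    using int by (subst set_integral_add) (auto intro!: set_integrable_mult_right)
  finally show ?thesis
    by (simp only: fourier_coeff_def add_divide_distrib times_divide_eq_right)
qed

lemma periodic_rot:
  assumes "periodic_fun_simple g T"
  shows "periodic_fun_simple (rot a g) T"
proof
  fix x
  show "rot a g (x + T) = rot a g x"
    using periodic_fun_simple.plus_period[OF assms, of "x - a"] by (simp add: rot_def algebra_simps)
qed

lemma set_integrable_rot:
  assumes "periodic_fun_simple \<phi> (2 * pi)" "set_integrable lborel {0..2 * pi} \<phi>"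
  shows "set_integrable lborel {0..2 * pi} (rot a \<phi>)"
  unfolding rot_def by (rule set_integrable_periodic_shift[OF assms(1) _ assms(2)]) simp

lemma fourier_coeff_mixture:
  assumes "periodic_fun_simple \<phi> (2 * pi)" "set_integrable lborel {0..2 * pi} \<phi>"
  shows "fourier_coeff (mixture p \<alpha> \<beta> \<phi>) l =
    (of_real p * cis (- of_int l * \<alpha>) + of_real (1 - p) * cis (- of_int l * \<beta>)) * fourier_coeff \<phi> l"
  unfolding mixture_def fourier_coeff_linear_combination[OF set_integrable_rot[OF assms] set_integrable_rot[OF assms]]
    fourier_coeff_rot[OF assms]
  by (simp add: algebra_simps)

lemma fourier_coeff_ae_cong:
  assumes "ae_eq g h" "g \<in> borel_measurable borel" "h \<in> borel_measurable borel"
  shows "fourier_coeff g l = fourier_coeff h l"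
proof -
  have [measurable]: "(\<lambda>x. exp (- (\<i> * of_int l * complex_of_real x))) \<in> borel_measurable borel"
    by (intro borel_measurable_continuous_onI continuous_intros)
  note [measurable] = assms(2,3)
  have "(LINT x:{0..2 * pi}|lborel. complex_of_real (g x) * exp (- (\<i> * of_int l * complex_of_real x))) =
     (LINT x:{0..2 * pi}|lborel. complex_of_real (h x) * exp (- (\<i> * of_int l * complex_of_real x)))"
    unfolding set_lebesgue_integral_def
    using assms(1) unfolding ae_eq_def by (intro integral_cong_AE) auto
  then show ?thesis by (simp add: fourier_coeff_def)
qed

text \<open>Write the two exponential sums as z = A - i B and z' = A' - i B'. Real proportionality
  makes them parallel in the plane, so the imaginary part A B' - B A' of z times the conjugate of z'
  vanishes; the addition formula for sine expands it into the four terms.\<close>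

lemma sin_balance_of_proportional:
  fixes c c' p p' \<alpha> \<beta> \<alpha>' \<beta>' k :: real
  assumes eq: "(of_real p * cis (- k * \<alpha>) + of_real q * cis (- k * \<beta>)) * of_real c =
      (of_real p' * cis (- k * \<alpha>') + of_real q' * cis (- k * \<beta>')) * of_real c'"
    and nz: "c' \<noteq> 0"
  shows "p * p' * sin (k * (\<alpha>' - \<alpha>)) + p * q' * sin (k * (\<beta>' - \<alpha>))
       + q * p' * sin (k * (\<alpha>' - \<beta>)) + q * q' * sin (k * (\<beta>' - \<beta>)) = 0"
proof -
  define A where "A = p * cos (k * \<alpha>) + q * cos (k * \<beta>)"
  define B where "B = p * sin (k * \<alpha>) + q * sin (k * \<beta>)"
  define A' where "A' = p' * cos (k * \<alpha>') + q' * cos (k * \<beta>')"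
  define B' where "B' = p' * sin (k * \<alpha>') + q' * sin (k * \<beta>')"
  have "A * c = A' * c'" "B * c = B' * c'"
    using eq by (auto simp: complex_eq_iff A_def B_def A'_def B'_def algebra_simps)
  then have "(A * B' - B * A') * c' = 0"
    by algebra
  then have "A * B' - B * A' = 0"
    using nz by simp
  then show ?thesis
    by (simp add: A_def B_def A'_def B'_def right_diff_distrib sin_diff algebra_simps)
qed

section \<open>Balanced sums of sines\<close>

text \<open>The Vandermonde argument in Lagrange form: vanishing moments make the sum of
  \<open>a i * poly P (c i)\<close> vanish for every \<open>P\<close> of degree below
  \<open>n\<close>, and a suitable \<open>P\<close> isolates the indices with
  \<open>c i = v\<close>.\<close>

lemma moments_zero_imp_fibre_sums_zero:
  fixes a c :: "'i \<Rightarrow> 'a::field"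
  assumes fin: "finite I" and card: "card I \<le> n"
    and moments: "\<And>k. k < n \<Longrightarrow> (\<Sum>i\<in>I. a i * c i ^ k) = 0"
  shows "(\<Sum>i\<in>{i\<in>I. c i = v}. a i) = 0"
proof (cases "{i\<in>I. c i = v} = {}")
  case False
  then obtain j where j: "j \<in> I" "c j = v" by blast
  \<comment> \<open>\<open>P\<close> vanishes at every value of \<open>c\<close> except
    \<open>v\<close>. Leaving out the factor for \<open>v\<close> keeps the degree strictly below
    the number of values, hence below \<open>n\<close>.\<close>
  define P where "P = (\<Prod>x\<in>c ` I - {v}. [:- x, 1:])"
  have poly_P: "poly P y = (\<Prod>x\<in>c ` I - {v}. y - x)" for y
    by (simp add: P_def poly_prod)
  have "degree P = card (c ` I - {v})"
    unfolding P_def by (subst degree_prod_sum_eq) auto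
  also have "\<dots> < card (c ` I)"
    using fin j by (intro psubset_card_mono) auto
  also have "\<dots> \<le> n"
    using card_image_le[OF fin, of c] card by simp
  finally have deg: "degree P < n" .
  have "poly P v * (\<Sum>i\<in>{i\<in>I. c i = v}. a i) = (\<Sum>i\<in>{i\<in>I. c i = v}. a i * poly P (c i))"
    by (simp add: sum_distrib_left mult.commute)
  also have "\<dots> = (\<Sum>i\<in>I. a i * poly P (c i))"
    using fin by (intro sum.mono_neutral_left) (auto simp: poly_P)
  also have "\<dots> = (\<Sum>k\<le>degree P. coeff P k * (\<Sum>i\<in>I. a i * c i ^ k))"
    unfolding poly_altdef sum_distrib_left by (subst sum.swap) (simp add: mult_ac)
  also have "\<dots> = 0"
    using deg by (intro sum.neutral) (auto simp: moments)
  finally show ?thesis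
    using fin by (simp add: poly_P)
next
  case True
  then show ?thesis by (simp only: sum.empty)
qed

lemma sin_times_cos_square: "sin u * cos u ^ 2 = (sin (3 * u) + sin u) / 4" for u :: real
proof -
  have "sin (3 * u) = sin (2 * u + u)" by simp
  also have "\<dots> = 2 * sin u * cos u ^ 2 + (2 * cos u ^ 2 - 1) * sin u"
    unfolding sin_add sin_double cos_double_cos by (simp add: power2_eq_square)
  finally show ?thesis by (simp add: algebra_simps)
qed

lemma sin_times_cos_cube: "sin u * cos u ^ 3 = (sin (4 * u) + 2 * sin (2 * u)) / 8" for u :: real
proof -
  have "sin (4 * u) = sin (2 * (2 * u))" by simp
  also have "\<dots> = 2 * (2 * sin u * cos u) * (2 * cos u ^ 2 - 1)"
    unfolding sin_double[of "2 * u"] sin_double[of u] cos_double_cos by simp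
  finally show ?thesis
    unfolding sin_double by (simp add: algebra_simps power2_eq_square power3_eq_cube)
qed

text \<open>Each sin u cos^k u with k < 4 is a combination of the sin (l u) with l in {1, 2, 3, 4},
  so the balances are four moments of the coefficients \<open>w i * sin (u i)\<close> at the nodes
  \<open>cos (u i)\<close>: just enough for four indices.\<close>

lemma sin_fibre_balance:
  fixes w u :: "nat \<Rightarrow> real"
  assumes bal: "\<And>l. l \<in> {1, 2, 3, 4} \<Longrightarrow> (\<Sum>i<4. w i * sin (l * u i)) = 0"
  shows "(\<Sum>i<4. if cos (u i) = v then w i * sin (u i) else 0) = 0"
proof -
  have "(\<Sum>i<4. w i * sin (u i) * cos (u i) ^ k) = 0" if "k < 4" for k
  proof -
    note b = bal[of 1, simplified] bal[of 2, simplified] bal[of 3, simplified] bal[of 4, simplified]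
    have "(\<Sum>i<4. w i * (sin (u i) * cos (u i))) = (\<Sum>i<4. w i * sin (2 * u i)) / 2"
      unfolding sin_double sum_divide_distrib by (simp add: mult_ac)
    moreover have "(\<Sum>i<4. w i * (sin (u i) * cos (u i) ^ 2)) =
        ((\<Sum>i<4. w i * sin (3 * u i)) + (\<Sum>i<4. w i * sin (u i))) / 4"
      unfolding sin_times_cos_square sum_divide_distrib sum.distrib[symmetric] by (simp add: algebra_simps)
    moreover have "(\<Sum>i<4. w i * (sin (u i) * cos (u i) ^ 3)) =
        ((\<Sum>i<4. w i * sin (4 * u i)) + 2 * (\<Sum>i<4. w i * sin (2 * u i))) / 8"
      unfolding sin_times_cos_cube sum_divide_distrib sum_distrib_left sum.distrib[symmetric]
      by (simp add: algebra_simps)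
    moreover have "k = 0 \<or> k = 1 \<or> k = 2 \<or> k = 3" using that by auto
    ultimately show ?thesis
      using b by (auto simp: mult.assoc)
  qed
  then have "(\<Sum>i\<in>{i\<in>{..<4}. cos (u i) = v}. w i * sin (u i)) = 0"
    by (intro moments_zero_imp_fibre_sums_zero[where n=4]) auto
  then show ?thesis
    by (subst (asm) sum.inter_filter) auto
qed

text \<open>Think of a 2 by 2 array with 1 and 4 on one diagonal, 2 and 3 on the other. By
  \<open>ne\<close>, neighbours with equal cosines have opposite sines, while diagonal pairs may
  have either sign. A fibre with nonzero sine then gives a signed sum of weights equal to zero,
  which the inequalities \<open>w\<close> mostly forbid.\<close>

lemma sin_balance_cases:
  fixes w1 w2 w3 w4 u1 u2 u3 u4 :: real
  assumes bal: "\<And>l. l \<in> {1, 2, 3, 4} \<Longrightarrow>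
      w1 * sin (l * u1) + w2 * sin (l * u2) + w3 * sin (l * u3) + w4 * sin (l * u4) = 0"
    and w: "0 < w1" "w1 < w2" "w1 < w3" "w2 < w4" "w3 < w4" "w2 + w3 < w1 + w4"
    and ne: "cis u1 \<noteq> cis u2" "cis u1 \<noteq> cis u3" "cis u4 \<noteq> cis u2" "cis u4 \<noteq> cis u3"
  obtains (degenerate) "sin u1 = 0" "sin u2 = 0" "sin u3 = 0" "sin u4 = 0"
    | (opposite) "sin u1 = 0" "sin u4 = 0" "cis u3 = cis (- u2)" "w2 = w3"
    | (triple) "sin u1 = 0" "sin u4 \<noteq> 0" "cis u2 = cis (- u4)" "cis u3 = cis (- u4)" "w4 = w2 + w3"
proof -
  define s1 s2 s3 s4 c1 c2 c3 c4 where defs: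
    "s1 = sin u1" "s2 = sin u2" "s3 = sin u3" "s4 = sin u4"
    "c1 = cos u1" "c2 = cos u2" "c3 = cos u3" "c4 = cos u4"
  have fibre: "(if c1 = v then w1 * s1 else 0) + (if c2 = v then w2 * s2 else 0)
      + (if c3 = v then w3 * s3 else 0) + (if c4 = v then w4 * s4 else 0) = 0" for v
  proof -
    have sum4: "(\<Sum>i<4. h i) = h 0 + h 1 + h 2 + h 3" for h :: "nat \<Rightarrow> real"
      by (simp add: eval_nat_numeral)
    define w u where "w = (!) [w1, w2, w3, w4]" and "u = (!) [u1, u2, u3, u4]"
    have w: "w 0 = w1" "w 1 = w2" "w 2 = w3" "w 3 = w4"
      and u: "u 0 = u1" "u 1 = u2" "u 2 = u3" "u 3 = u4"
      by (simp_all add: w_def u_def)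
    show ?thesis
      using sin_fibre_balance[of w u v] bal unfolding sum4 w u defs by blast
  qed
  have circle: "sin x = sin y \<or> sin x = - sin y" if "cos x = cos y" for x y :: real
    using sin_cos_squared_add[of x] sin_cos_squared_add[of y] that
    by (metis add_right_cancel power2_eq_iff)
  have c12: "c1 = c2 \<Longrightarrow> s1 = - s2" and c13: "c1 = c3 \<Longrightarrow> s1 = - s3"
    and c42: "c4 = c2 \<Longrightarrow> s4 = - s2" and c43: "c4 = c3 \<Longrightarrow> s4 = - s3"
    and c23: "c2 = c3 \<Longrightarrow> s2 = s3 \<or> s2 = - s3" and c14: "c1 = c4 \<Longrightarrow> s1 = s4 \<or> s1 = - s4"
    using circle ne unfolding defs by (metis complex_eq_iff cis.sel)+
  show thesis
  proof (cases "s4 = 0")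
    case False
    have "c2 = c4 \<and> c3 = c4 \<and> c1 \<noteq> c4 \<and> w4 = w2 + w3"
    proof -
      \<comment> \<open>Signed weights of the fibre of \<open>c4\<close> after division by
        \<open>s4\<close>. No single weight cancels \<open>w4\<close>; if index 1 joins a neighbour
        in the fibre, its sign is positive and \<open>w2 + w3 < w1 + w4\<close> excludes the
        balance. What remains is \<open>w4 = w2 + w3\<close>.\<close>
      define k1 k2 k3 where k: "k1 = (if c1 = c4 then if s1 = s4 then w1 else - w1 else 0)"
        "k2 = (if c2 = c4 then w2 else 0)" "k3 = (if c3 = c4 then w3 else 0)"
      have "(if c1 = c4 then w1 * s1 else 0) = k1 * s4"
        unfolding k by (cases "c1 = c4"; cases "s1 = s4") (use c14 in simp_all)
      moreover have "(if c2 = c4 then w2 * s2 else 0) = - k2 * s4"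
        unfolding k by (cases "c2 = c4") (use c42 in simp_all)
      moreover have "(if c3 = c4 then w3 * s3 else 0) = - k3 * s4"
        unfolding k by (cases "c3 = c4") (use c43 in simp_all)
      ultimately have "(k1 - k2 - k3 + w4) * s4 = 0"
        using fibre[of c4] by (simp add: algebra_simps)
      then have "k1 - k2 - k3 + w4 = 0"
        using False by simp
      moreover have "s1 = s4" if "c1 = c4" "c2 = c4"
        using c12 c42 that by simp
      moreover have "s1 = s4" if "c1 = c4" "c3 = c4"
        using c13 c43 that by simp
      ultimately show ?thesis
        using w unfolding k by (auto split: if_splits)
    qed
    note eqs = this
    \<comment> \<open>Index 1 is now alone in its fibre.\<close>
    then have "w1 * s1 = 0"
      using fibre[of c1] by auto
    then have "s1 = 0" using w by simp
    moreover have "s2 = - s4" "s3 = - s4"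
      using eqs c42 c43 by auto
    ultimately show thesis
      using triple eqs False by (auto simp: complex_eq_iff defs)
  next
    case s4: True
    have s2_imp: "c3 = c2 \<and> c1 \<noteq> c2 \<and> s3 = - s2 \<and> w2 = w3" if nz: "s2 \<noteq> 0"
    proof -
      \<comment> \<open>The same count for the fibre of \<open>c2\<close>, where index 4 contributes
        nothing: \<open>w1\<close> is too small to cancel \<open>w2\<close>, and if index 1 lies in
        the fibre with index 3 then \<open>s3 = s2\<close>, so \<open>w3\<close> has the wrong sign.
        Only \<open>w3\<close> with opposite sine can balance \<open>w2\<close>.\<close>
      define k1 k3 where k: "k1 = (if c1 = c2 then w1 else 0)"
        "k3 = (if c3 = c2 then if s3 = s2 then w3 else - w3 else 0)"
      have "(if c1 = c2 then w1 * s1 else 0) = - k1 * s2"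
        unfolding k by (cases "c1 = c2") (use c12 in simp_all)
      moreover have "(if c3 = c2 then w3 * s3 else 0) = k3 * s2"
        unfolding k by (cases "c3 = c2"; cases "s3 = s2") (use c23 in auto)
      moreover have "(if c4 = c2 then w4 * s4 else 0) = 0"
        using s4 by simp
      ultimately have "(w2 - k1 + k3) * s2 = 0"
        using fibre[of c2] by (simp add: algebra_simps)
      then have "w2 - k1 + k3 = 0"
        using nz by simp
      moreover have "s3 = s2" if "c1 = c2" "c3 = c2"
        using c12 c13 that by simp
      ultimately show ?thesis
        using w c23 unfolding k by (auto split: if_splits)
    qed
    show thesis
    proof (cases "s2 = 0")
      case False
      then have eqs: "c3 = c2 \<and> c1 \<noteq> c2 \<and> s3 = - s2 \<and> w2 = w3"
        by (rule s2_imp)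
      then have "w1 * s1 = 0"
        using fibre[of c1] s4 by (auto split: if_splits)
      then have "s1 = 0" using w by simp
      then show thesis
        using opposite eqs s4 by (auto simp: complex_eq_iff defs)
    next
      case s2: True
      have s3: "s3 = 0"
      proof (rule ccontr)
        assume nz: "s3 \<noteq> 0"
        \<comment> \<open>Only index 1 could still balance index 3, but
          \<open>w1 < w3\<close>.\<close>
        have "(if c1 = c3 then w1 * s1 else 0) = (if c1 = c3 then - w1 else 0) * s3"
          by (cases "c1 = c3") (use c13 in simp_all)
        then have "((if c1 = c3 then - w1 else 0) + w3) * s3 = 0"
          using fibre[of c3] s2 s4 by (simp add: distrib_right cong: if_cong)
        then show False
          using nz w by (auto split: if_splits)
      qed
      then have "w1 * s1 = 0"
        using fibre[of c1] s2 s4 by (auto split: if_splits)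
      then have "s1 = 0" using w by simp
      then show thesis
        using degenerate s2 s3 s4 by (auto simp: defs)
    qed
  qed
qed

lemma sin_zero_rcong: "sin u = 0 \<longleftrightarrow> [u = 0] (rmod 2 * pi) \<or> [u = pi] (rmod 2 * pi)"
  using sin_eq_sin_conv_rmod_iff[of u 0] by simp

lemma rot_cong:
  assumes "periodic_fun_simple f (2 * pi)" "[a = b] (rmod 2 * pi)"
  shows "rot a f = rot b f"
proof
  fix x
  interpret periodic_fun_simple f "2 * pi" by (fact assms(1))
  obtain n :: int where "b = a + of_int n * (2 * pi)"
    using assms(2) by (auto simp: rcong_altdef)
  then show "rot a f x = rot b f x"
    using minus_of_int[of "x - a" n] by (simp add: rot_def algebra_simps)
qed

section \<open>Inverting shifts of finite order\<close>

text \<open>With S the shift by \<tau> and S^2 = 1, the inverse of P + Q S is (P - Q S) / (P^2 -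
  Q^2).\<close>

lemma two_point_deconvolution:
  fixes f g :: "real \<Rightarrow> real"
  assumes f: "periodic_fun_simple f (2 * \<tau>)" and g: "periodic_fun_simple g (2 * \<tau>)"
    and nz: "P\<^sup>2 \<noteq> Q\<^sup>2"
    and eq: "AE x in lborel. p * f x + q * f (x - \<tau>) = P * g x + Q * g (x - \<tau>)"
  shows "\<exists>a b. AE x in lborel. g x = a * f x + b * f (x - \<tau>)"
proof -
  interpret f: periodic_fun_simple f "2 * \<tau>" by (fact f)
  interpret g: periodic_fun_simple g "2 * \<tau>" by (fact g)
  have "AE x in lborel. g x = (P * p - Q * q) / (P\<^sup>2 - Q\<^sup>2) * f x + (P * q - Q * p) / (P\<^sup>2 - Q\<^sup>2) * f (x - \<tau>)"
    using eq AE_lborel_shift[OF eq, of \<tau>]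
  proof eventually_elim
    case (elim x)
    have "f (x - \<tau> - \<tau>) = f x" "g (x - \<tau> - \<tau>) = g x"
      using f.minus_1[of x] g.minus_1[of x] by (simp_all add: algebra_simps)
    with elim have "p * f x + q * f (x - \<tau>) = P * g x + Q * g (x - \<tau>)"
      "p * f (x - \<tau>) + q * f x = P * g (x - \<tau>) + Q * g x"
      by simp_all
    then have "(P\<^sup>2 - Q\<^sup>2) * g x = (P * p - Q * q) * f x + (P * q - Q * p) * f (x - \<tau>)"
      by algebra
    then have "g x = ((P * p - Q * q) * f x + (P * q - Q * p) * f (x - \<tau>)) / (P\<^sup>2 - Q\<^sup>2)"
      using nz by (metis eq_iff_diff_eq_0 nonzero_mult_div_cancel_left)
    then show ?case by (simp only: add_divide_distrib times_divide_eq_left)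
  qed
  then show ?thesis by blast
qed

text \<open>With S the shift by tau and S^3 = 1, the inverse of P + Q S is (P^2 - P Q S + Q^2 S^2) / (P^3 + Q^3).\<close>

lemma three_point_deconvolution:
  fixes f g :: "real \<Rightarrow> real"
  assumes f: "periodic_fun_simple f (3 * \<tau>)" and g: "periodic_fun_simple g (3 * \<tau>)"
    and nz: "P ^ 3 + Q ^ 3 \<noteq> 0"
    and eq: "AE x in lborel. p * f x + q * f (x - \<tau>) = P * g x + Q * g (x + \<tau>)"
  shows "\<exists>a b c. AE x in lborel. g x = a * f (x - \<tau>) + b * f (x + \<tau>) + c * f x"
proof -
  interpret f: periodic_fun_simple f "3 * \<tau>" by (fact f)
  interpret g: periodic_fun_simple g "3 * \<tau>" by (fact g)
  let ?D = "P ^ 3 + Q ^ 3"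
  have "AE x in lborel. g x = (P\<^sup>2 * q + Q\<^sup>2 * p) / ?D * f (x - \<tau>) + (Q\<^sup>2 * q - P * Q * p) / ?D * f (x + \<tau>)
      + (P\<^sup>2 * p - P * Q * q) / ?D * f x"
    \<comment> \<open>The equation at \<open>x\<close>, \<open>x + \<tau>\<close> and
      \<open>x + 2 * \<tau>\<close>, the last point being identified with \<open>x - \<tau>\<close>,
      is a circulant system for the three values of \<open>g\<close>.\<close>
    using eq AE_lborel_shift[OF eq, of "- \<tau>"] AE_lborel_shift[OF eq, of "- 2 * \<tau>"]
  proof eventually_elim
    case (elim x)
    have "x - - 2 * \<tau> = x - \<tau> + 3 * \<tau>" "x - - 2 * \<tau> + \<tau> = x + 3 * \<tau>"
      "x - - 2 * \<tau> - \<tau> = x + \<tau>" "x - - \<tau> - \<tau> = x" "x - - \<tau> = x + \<tau>" "x + \<tau> + \<tau> = x - - 2 * \<tau>"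
      by simp_all
    with elim have E: "p * f x + q * f (x - \<tau>) = P * g x + Q * g (x + \<tau>)"
      "p * f (x + \<tau>) + q * f x = P * g (x + \<tau>) + Q * g (x - \<tau>)"
      "p * f (x - \<tau>) + q * f (x + \<tau>) = P * g (x - \<tau>) + Q * g x"
      by (simp_all only: f.plus_period g.plus_period)
    then have "?D * g x = (P\<^sup>2 * q + Q\<^sup>2 * p) * f (x - \<tau>) + (Q\<^sup>2 * q - P * Q * p) * f (x + \<tau>)
      + (P\<^sup>2 * p - P * Q * q) * f x"
      by algebra
    then have "g x = ((P\<^sup>2 * q + Q\<^sup>2 * p) * f (x - \<tau>) + (Q\<^sup>2 * q - P * Q * p) * f (x + \<tau>)
      + (P\<^sup>2 * p - P * Q * q) * f x) / ?D"
      using nz by (metis nonzero_mult_div_cancel_left)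
    moreover have "(X * u + Y * v + Z * w) / ?D = X / ?D * u + Y / ?D * v + Z / ?D * w" for X Y Z u v w
      by (simp add: add_divide_distrib)
    ultimately show ?case by simp
  qed
  then show ?thesis by blast
qed

section \<open>Identifiability\<close>

lemma rcongI: "b = a + of_int n * m \<Longrightarrow> [a = b] (rmod m)"
  by (auto simp: rcong_altdef)

lemma rcong_diff_iff: "[x - y = z] (rmod m) \<longleftrightarrow> [x = y + z] (rmod m)"
  using rcong_diff_right_cancel[of x y "y + z" m] by simp

text \<open>Here \<open>u\<close> is a multiple of pi / 3 but not of pi. Take \<delta> and \<tau> as
  the classes of -3 u and -2 u; their sum is the class of -5 u, which is that of u because 6 u is a
  multiple of 2 pi.\<close>

lemma triple_angle_rcong:
  assumes "sin (3 * u) = 0" "sin u \<noteq> 0"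
  obtains \<tau> \<delta> where "\<tau> \<in> {2 * pi / 3, - (2 * pi / 3)}" "\<delta> \<in> {0, pi}"
    "[u = \<delta> + \<tau>] (rmod 2 * pi)" "[- 3 * u = \<delta>] (rmod 2 * pi)" "[- 2 * u = \<tau>] (rmod 2 * pi)"
proof -
  obtain n :: int where n: "3 * u = of_int n * pi"
    using assms(1) by (auto simp: sin_zero_iff_int2)
  \<comment> \<open>Modulo 2 pi only the residue of \<open>n\<close> modulo 6 matters; residues 0
    and 3 are the multiples of pi.\<close>
  define k r where "k = n div 6" and "r = n mod 6"
  have nr: "n = 6 * k + r" by (simp add: k_def r_def)
  have u: "u = of_int r * pi / 3 + of_int k * (2 * pi)"
    using n by (simp add: nr field_simps)
  have "r \<in> {0, 1, 2, 3, 4, 5}"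
    unfolding r_def by auto
  moreover have "sin u = sin (of_int r * pi / 3)"
    by (rule sin_rcong, rule rcongI[of _ _ "- k"], simp add: u)
  then have "r \<noteq> 0" "r \<noteq> 3"
    using assms(2) by auto
  ultimately consider "r = 1" | "r = 2" | "r = 4" | "r = 5"
    by auto
  then show thesis
  proof cases
    case 1
    show thesis
      by (rule that[of "- (2 * pi / 3)" pi], simp, simp,
          rule rcongI[of _ _ "- k"], simp add: u 1 field_simps,
          rule rcongI[of _ _ "1 + 3 * k"], simp add: u 1 field_simps,
          rule rcongI[of _ _ "2 * k"], simp add: u 1 field_simps)
  next
    case 2
    show thesis
      by (rule that[of "2 * pi / 3" 0], simp, simp,
          rule rcongI[of _ _ "- k"], simp add: u 2 field_simps,
          rule rcongI[of _ _ "1 + 3 * k"], simp add: u 2 field_simps,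
          rule rcongI[of _ _ "1 + 2 * k"], simp add: u 2 field_simps)
  next
    case 3
    show thesis
      by (rule that[of "- (2 * pi / 3)" 0], simp, simp,
          rule rcongI[of _ _ "- 1 - k"], simp add: u 3 field_simps,
          rule rcongI[of _ _ "2 + 3 * k"], simp add: u 3 field_simps,
          rule rcongI[of _ _ "1 + 2 * k"], simp add: u 3 field_simps)
  next
    case 4
    show thesis
      by (rule that[of "2 * pi / 3" pi], simp, simp,
          rule rcongI[of _ _ "- k"], simp add: u 4 field_simps,
          rule rcongI[of _ _ "3 + 3 * k"], simp add: u 4 field_simps,
          rule rcongI[of _ _ "2 + 2 * k"], simp add: u 4 field_simps)
  qed
qed

lemma density_classD:
  assumes "f \<in> density_class"
  shows "periodic_fun_simple f (2 * pi)" "set_integrable lborel {0..2 * pi} f"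
    "f \<in> borel_measurable borel"
    "l \<in> {1, 2, 3, 4} \<Longrightarrow> \<exists>c. c \<noteq> 0 \<and> fourier_coeff f l = complex_of_real c"
  using assms by (auto simp: density_class_def circle_density_def elim!: Reals_cases)

lemma parameter_setD:
  assumes "(p, \<alpha>, \<beta>) \<in> parameter_set"
  shows "0 < p" "p < 1 / 2" "\<not> [\<alpha> = \<beta>] (rmod 2 * pi)"
  using assms by (auto simp: parameter_set_def)

lemma mixture_sin_balance:
  assumes f: "f \<in> density_class" and f': "f' \<in> density_class"
    and eq: "ae_eq (mixture p \<alpha> \<beta> f) (mixture p' \<alpha>' \<beta>' f')"
    and l: "l \<in> {1, 2, 3, 4 :: real}"
  shows "p * p' * sin (l * (\<alpha>' - \<alpha>)) + p * (1 - p') * sin (l * (\<beta>' - \<alpha>))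
       + (1 - p) * p' * sin (l * (\<alpha>' - \<beta>)) + (1 - p) * (1 - p') * sin (l * (\<beta>' - \<beta>)) = 0"
proof -
  obtain k :: int where k: "k \<in> {1, 2, 3, 4}" "l = of_int k"
    using l by force
  obtain c where c: "fourier_coeff f k = complex_of_real c"
    using density_classD(4)[OF f k(1)] by auto
  obtain c' where c': "c' \<noteq> 0" "fourier_coeff f' k = complex_of_real c'"
    using density_classD(4)[OF f' k(1)] by auto
  have [measurable]: "mixture r a b g \<in> borel_measurable borel"
    if g: "g \<in> density_class" for r a b g
    using density_classD(3)[OF g] unfolding mixture_def rot_def by measurable
  have "fourier_coeff (mixture p \<alpha> \<beta> f) k = fourier_coeff (mixture p' \<alpha>' \<beta>' f') k"
    using f f' by (intro fourier_coeff_ae_cong[OF eq]) measurable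
  then show ?thesis
    using c'(1) unfolding fourier_coeff_mixture[OF density_classD(1,2)[OF f]]
      fourier_coeff_mixture[OF density_classD(1,2)[OF f']] c c'(2) k(2)
    by (rule sin_balance_of_proportional)
qed

text \<open>Translating so that the first component of the left mixture sits at 0 leaves only
  differences of angles, the quantities that the sine balance controls.\<close>

lemma ae_eq_mixture_relative:
  assumes "ae_eq (mixture p \<alpha> \<beta> f) (mixture p' \<alpha>' \<beta>' f')"
  shows "AE x in lborel. p * f x + (1 - p) * rot (\<beta> - \<alpha>) f x =
    p' * rot (\<alpha>' - \<alpha>) f' x + (1 - p') * rot (\<beta>' - \<alpha>) f' x"
  using AE_lborel_shift[OF assms[unfolded ae_eq_def], of "- \<alpha>"]
  by (simp add: mixture_def rot_def algebra_simps)

text \<open>The difference \<open>h\<close> of \<open>rot \<delta> f'\<close> and \<open>f\<close>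
  satisfies p h + (1 - p) h_\<gamma> = 0, and p < 1 - p makes this a strict contraction.\<close>

lemma mixture_same_parameters:
  assumes f: "periodic_fun_simple f (2 * pi)" "set_integrable lborel {0..2 * pi} f"
    and f': "periodic_fun_simple f' (2 * pi)" "set_integrable lborel {0..2 * pi} f'"
    and p: "0 < p" "p < 1 / 2"
    and eq: "AE x in lborel. p * f x + (1 - p) * rot \<gamma> f x = p * rot \<delta> f' x + (1 - p) * rot (\<delta> + \<gamma>) f' x"
  shows "ae_eq f' (rot (- \<delta>) f)"
proof -
  define h where "h = (\<lambda>x. rot \<delta> f' x - f x)"
  have "periodic_fun_simple h (2 * pi)"
    by standard (simp add: h_def periodic_fun_simple.plus_period[OF f(1)]
        periodic_fun_simple.plus_period[OF periodic_rot[OF f'(1)]])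
  moreover have "set_integrable lborel {0..2 * pi} h"
    unfolding h_def by (intro set_integral_diff f set_integrable_rot f')
  moreover have "AE x in lborel. p * h (x - 0) + (1 - p) * h (x - \<gamma>) = 0"
    using eq by eventually_elim (simp add: h_def rot_def algebra_simps)
  moreover have "\<bar>p\<bar> < \<bar>1 - p\<bar>" using p by simp
  ultimately have "AE x in lborel. h x = 0"
    by (intro AE_eq_zero_if_contracted[of h "2 * pi" p "1 - p" 0 \<gamma>]) simp_all
  from AE_lborel_shift[OF this, of "- \<delta>"] show ?thesis
    by (simp add: ae_eq_def h_def rot_def)
qed

theorem theorem1:
  fixes p p' \<alpha> \<alpha>' \<beta> \<beta>' :: real and f f' :: "real \<Rightarrow> real"
  assumes "(p, \<alpha>, \<beta>) \<in> parameter_set" and "(p', \<alpha>', \<beta>') \<in> parameter_set"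
    and "f \<in> density_class" and "f' \<in> density_class"
    and "ae_eq (mixture p \<alpha> \<beta> f) (mixture p' \<alpha>' \<beta>' f')"
  shows
    "(p' = p \<and> [\<alpha>' = \<alpha>] (rmod (2 * pi)) \<and> [\<beta>' = \<beta>] (rmod (2 * pi)) \<and> ae_eq f' f)
   \<or> (p' = p \<and> [\<alpha>' = \<alpha> + pi] (rmod (2 * pi)) \<and> [\<beta>' = \<beta> + pi] (rmod (2 * pi)) \<and>
        ae_eq f' (rot pi f))
   \<or> ([\<beta> - \<alpha> = pi] (rmod (2 * pi)) \<and>
        (\<exists>a b. ae_eq f' (\<lambda>x. a * f x + b * rot pi f x)) \<and>
        ([\<alpha>' = \<alpha>] (rmod (2 * pi)) \<and> [\<beta>' = \<beta>] (rmod (2 * pi)) \<or>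
         [\<alpha>' = \<beta>] (rmod (2 * pi)) \<and> [\<beta>' = \<alpha>] (rmod (2 * pi))))
   \<or> (([\<beta> - \<alpha> = 2 * pi / 3] (rmod (2 * pi)) \<or> [\<beta> - \<alpha> = - (2 * pi / 3)] (rmod (2 * pi))) \<and>
        p' = (1 - 2 * p) / (2 - 3 * p) \<and>
        ([\<beta> - \<alpha> = 2 * pi / 3] (rmod (2 * pi)) \<longrightarrow>
           [\<alpha>' = \<alpha> + pi] (rmod (2 * pi)) \<and> [\<beta>' = \<beta> - pi / 3] (rmod (2 * pi)) \<and>
           (\<exists>a b c. ae_eq f' (\<lambda>x. a * rot (pi / 3) f x + b * rot (- (pi / 3)) f x + c * rot pi f x))
         \<or> [\<alpha>' = \<alpha>] (rmod (2 * pi)) \<and> [\<beta>' = \<beta> + 2 * pi / 3] (rmod (2 * pi)) \<and>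
           (\<exists>a b c. ae_eq f' (\<lambda>x. a * rot (2 * pi / 3) f x + b * rot (- (2 * pi / 3)) f x + c * f x))) \<and>
        ([\<beta> - \<alpha> = - (2 * pi / 3)] (rmod (2 * pi)) \<longrightarrow>
           [\<alpha>' = \<alpha> + pi] (rmod (2 * pi)) \<and> [\<beta>' = \<beta> + pi / 3] (rmod (2 * pi)) \<and>
           (\<exists>a b c. ae_eq f' (\<lambda>x. a * rot (pi / 3) f x + b * rot (- (pi / 3)) f x + c * rot pi f x))
         \<or> [\<alpha>' = \<alpha>] (rmod (2 * pi)) \<and> [\<beta>' = \<beta> - 2 * pi / 3] (rmod (2 * pi)) \<and>
           (\<exists>a b c. ae_eq f' (\<lambda>x. a * rot (2 * pi / 3) f x + b * rot (- (2 * pi / 3)) f x + c * f x))))"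
proof -
  note p = parameter_setD[OF assms(1)] and p' = parameter_setD[OF assms(2)]
  note f = density_classD(1,2)[OF assms(3)] and f' = density_classD(1,2)[OF assms(4)]
  note rf = rot_cong[OF f(1)] and rf' = rot_cong[OF f'(1)]
  note rel = ae_eq_mixture_relative[OF assms(5)]
  \<comment> \<open>The identities \<open>u1 + u4 = u2 + u3\<close> and
    \<open>u2 - u4 = \<beta> - \<alpha>\<close> are used repeatedly below.\<close>
  define u1 u2 u3 u4 where u: "u1 = \<alpha>' - \<alpha>" "u2 = \<beta>' - \<alpha>" "u3 = \<alpha>' - \<beta>" "u4 = \<beta>' - \<beta>"
  note rel' = rel[folded u]
  have bal: "p * p' * sin (l * u1) + p * (1 - p') * sin (l * u2)
      + (1 - p) * p' * sin (l * u3) + (1 - p) * (1 - p') * sin (l * u4) = 0" if "l \<in> {1, 2, 3, 4}" for l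
    unfolding u using assms(3-5) that by (rule mixture_sin_balance)
  have w: "0 < p * p'" "p * p' < p * (1 - p')" "p * p' < (1 - p) * p'"
    "p * (1 - p') < (1 - p) * (1 - p')" "(1 - p) * p' < (1 - p) * (1 - p')"
    using p p' by auto
  \<comment> \<open>This product is exactly the diagonal weights minus the off-diagonal
    ones.\<close>
  have "0 < (1 - 2 * p) * (1 - 2 * p')"
    using p p' by (intro mult_pos_pos) auto
  then have w': "p * (1 - p') + (1 - p) * p' < p * p' + (1 - p) * (1 - p')"
    by (simp add: algebra_simps)
  \<comment> \<open>Each of these congruences would merge the two angles of one of the
    mixtures.\<close>
  have ne: "\<not> [u1 = u2] (rmod 2 * pi)" "\<not> [u1 = u3] (rmod 2 * pi)"
    "\<not> [u4 = u2] (rmod 2 * pi)" "\<not> [u4 = u3] (rmod 2 * pi)"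
    using p(3) p'(3) unfolding u by (simp_all add: rcong_sym_iff)
  show ?thesis
  proof (rule sin_balance_cases[OF bal w w' ne[folded cis_eq_iff]], unfold cis_eq_iff)

    \<comment> \<open>Antipodal components: all four shifts are multiples of pi\<close>
    assume s: "sin u1 = 0" "sin u2 = 0" "sin u3 = 0" "sin u4 = 0"
    \<comment> \<open>\<open>P\<close> and \<open>Q\<close> will be p' and 1 - p', in the order
      fixed by whether the components keep or exchange their places.\<close>
    have E: "(AE x in lborel. p * f x + (1 - p) * f (x - pi) = P * f' x + Q * f' (x - pi)) \<Longrightarrow> P\<^sup>2 \<noteq> Q\<^sup>2 \<Longrightarrow>
        \<exists>a b. ae_eq f' (\<lambda>x. a * f x + b * rot pi f x)" for P Q
      using two_point_deconvolution[of f pi f' P Q p "1 - p"] f(1) f'(1)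
      by (simp add: ae_eq_def rot_def)
    have sq: "p'\<^sup>2 < (1 - p')\<^sup>2"
      using p' by (intro power_strict_mono) auto
    show ?thesis
    proof (cases "[u1 = 0] (rmod 2 * pi)")
      case True
      then have z: "[u2 = pi] (rmod 2 * pi)" "[u3 = pi] (rmod 2 * pi)"
        using s ne rcong_trans rcong_sym unfolding sin_zero_rcong by meson+
      have "[\<beta> - \<alpha> = 0 - pi] (rmod 2 * pi)"
        using rcong_diff[OF True z(2)] by (simp add: u)
      also have "[0 - pi = pi] (rmod 2 * pi)"
        by (rule rcongI[of _ _ 1]) simp
      finally have d: "[\<beta> - \<alpha> = pi] (rmod 2 * pi)" .
      have "[\<beta>' - \<alpha> = \<beta> - \<alpha>] (rmod 2 * pi)"
        using rcong_trans[OF z(1) rcong_sym[OF d]] by (simp add: u)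
      then have b: "[\<beta>' = \<beta>] (rmod 2 * pi)" by simp
      have a: "[\<alpha>' = \<alpha>] (rmod 2 * pi)"
        using True unfolding u rcong_diff_iff by simp
      have "AE x in lborel. p * f x + (1 - p) * f (x - pi) = p' * f' x + (1 - p') * f' (x - pi)"
        using rel' unfolding rf[OF d] rf'[OF True] rf'[OF z(1)] by (simp add: rot_def)
      from E[OF this] sq show ?thesis
        using a b d by auto
    next
      case False
      then have z0: "[u1 = pi] (rmod 2 * pi)"
        using s unfolding sin_zero_rcong by blast
      then have z: "[u2 = 0] (rmod 2 * pi)" "[u3 = 0] (rmod 2 * pi)"
        using s ne rcong_trans rcong_sym unfolding sin_zero_rcong by meson+
      have d: "[\<beta> - \<alpha> = pi] (rmod 2 * pi)"
        using rcong_diff[OF z0 z(2)] by (simp add: u)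
      have a: "[\<alpha>' = \<beta>] (rmod 2 * pi)"
        using z(2) unfolding u rcong_diff_iff by simp
      have b: "[\<beta>' = \<alpha>] (rmod 2 * pi)"
        using z(1) unfolding u rcong_diff_iff by simp
      have "AE x in lborel. p * f x + (1 - p) * f (x - pi) = (1 - p') * f' x + p' * f' (x - pi)"
        using rel' unfolding rf[OF d] rf'[OF z0] rf'[OF z(1)] by (simp add: rot_def algebra_simps)
      from E[OF this] sq show ?thesis
        using a b d by auto
    qed
  next

    \<comment> \<open>Equal weights and a common shift by 0 or pi\<close>
    assume s: "sin u1 = 0" "sin u4 = 0" and u32: "[u3 = - u2] (rmod 2 * pi)"
      and weq: "p * (1 - p') = (1 - p) * p'"
    have pp: "p' = p" using weq by (simp add: algebra_simps)
    have "[- u1 + (u2 + u3) = - u1 + (u2 + - u2)] (rmod 2 * pi)"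
      by (intro rcong_add rcong_refl u32)
    then have u41: "[u4 = - u1] (rmod 2 * pi)"
      by (simp add: u)
    obtain \<delta> where \<delta>: "\<delta> \<in> {0, pi}" "[u1 = \<delta>] (rmod 2 * pi)"
      using s(1) unfolding sin_zero_rcong by blast
    \<comment> \<open>As \<delta> is 0 or pi, its sign is irrelevant; hence both components move by
      the same \<delta>.\<close>
    have neg: "[- \<delta> = \<delta>] (rmod 2 * pi)"
    proof (cases "\<delta> = 0")
      case False
      then show ?thesis
        using \<delta>(1) by (intro rcongI[of _ _ 1]) auto
    qed simp
    have "[u4 = \<delta>] (rmod 2 * pi)"
      using u41 rcong_uminus[OF \<delta>(2)] neg rcong_trans by blast
    then have u2: "[u2 = \<delta> + (\<beta> - \<alpha>)] (rmod 2 * pi)" and b: "[\<beta>' = \<beta> + \<delta>] (rmod 2 * pi)"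
      using rcong_add[of u4 \<delta> "2 * pi" "\<beta> - \<alpha>" "\<beta> - \<alpha>"] unfolding u rcong_diff_iff
      by (simp_all add: add.commute)
    have a: "[\<alpha>' = \<alpha> + \<delta>] (rmod 2 * pi)"
      using \<delta>(2) unfolding u rcong_diff_iff by simp
    have "AE x in lborel. p * f x + (1 - p) * rot (\<beta> - \<alpha>) f x =
        p * rot \<delta> f' x + (1 - p) * rot (\<delta> + (\<beta> - \<alpha>)) f' x"
      using rel' unfolding rf'[OF \<delta>(2)] rf'[OF u2] pp .
    then have "ae_eq f' (rot (- \<delta>) f)"
      by (rule mixture_same_parameters[OF f f' p(1,2)])
    then have "ae_eq f' (rot \<delta> f)"
      unfolding rf[OF neg] .
    note res = this a b pp
    show ?thesis
    proof (cases "\<delta> = 0")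
      case True
      have "rot 0 f = f" by (simp add: rot_def)
      with res show ?thesis
        unfolding True by (intro disjI1 conjI) simp_all
    next
      case False
      with \<delta>(1) have "\<delta> = pi" by simp
      with res show ?thesis
        by (intro disjI2[OF disjI1] conjI) simp_all
    qed
  next

    \<comment> \<open>Components at distance 2 pi / 3\<close>
    assume s: "sin u1 = 0" "sin u4 \<noteq> 0"
      and u24: "[u2 = - u4] (rmod 2 * pi)" and u34: "[u3 = - u4] (rmod 2 * pi)"
      and weq: "(1 - p) * (1 - p') = p * (1 - p') + (1 - p) * p'"
    have "p' * (2 - 3 * p) = 1 - 2 * p"
      using weq by (simp add: algebra_simps)
    then have p'_eq: "p' = (1 - 2 * p) / (2 - 3 * p)"
      using p by (simp add: eq_divide_eq)
    \<comment> \<open>Both \<open>u1 = u2 + u3 - u4\<close> and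
      \<open>\<beta> - \<alpha> = u2 - u4\<close> become multiples of \<open>u4\<close>.\<close>
    have "[(u2 + u3) - u4 = (- u4 + - u4) - u4] (rmod 2 * pi)"
      by (intro rcong_intros u24 u34)
    then have u1: "[u1 = - 3 * u4] (rmod 2 * pi)"
      by (simp add: u)
    have "[u2 - u4 = - u4 - u4] (rmod 2 * pi)"
      by (intro rcong_diff rcong_refl u24)
    then have d4: "[\<beta> - \<alpha> = - 2 * u4] (rmod 2 * pi)"
      by (simp add: u)
    have "sin (- 3 * u4) = sin u1"
      using sin_rcong[OF u1] by (rule sym)
    then have "sin (3 * u4) = 0"
      using s(1) by simp
    then obtain \<tau> \<delta> where \<tau>: "\<tau> \<in> {2 * pi / 3, - (2 * pi / 3)}" and \<delta>: "\<delta> \<in> {0, pi}"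
      and u4: "[u4 = \<delta> + \<tau>] (rmod 2 * pi)"
      and \<delta>u: "[- 3 * u4 = \<delta>] (rmod 2 * pi)" and \<tau>u: "[- 2 * u4 = \<tau>] (rmod 2 * pi)"
      using s(2) by (rule triple_angle_rcong)
    have d: "[\<beta> - \<alpha> = \<tau>] (rmod 2 * pi)" and u1: "[u1 = \<delta>] (rmod 2 * pi)"
      using rcong_trans[OF d4 \<tau>u] rcong_trans[OF u1 \<delta>u] .
    have "[- 3 * u4 - - 2 * u4 = \<delta> - \<tau>] (rmod 2 * pi)"
      by (intro rcong_intros \<delta>u \<tau>u)
    with u24 have u2: "[u2 = \<delta> - \<tau>] (rmod 2 * pi)"
      using rcong_trans by simp
    have a: "[\<alpha>' = \<alpha> + \<delta>] (rmod 2 * pi)" and b: "[\<beta>' = \<beta> + (\<delta> + \<tau>)] (rmod 2 * pi)"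
      using u1 u4 unfolding u rcong_diff_iff by simp_all
    have \<tau>3: "3 * \<tau> = 2 * pi \<or> 3 * \<tau> = - (2 * pi)"
      using \<tau> by auto
    \<comment> \<open>Since 3 \<tau> is 2 pi or -2 pi, the three-point inversion covers both
      orientations at once.\<close>
    have per3: "periodic_fun_simple g (3 * \<tau>)" if "periodic_fun_simple g (2 * pi)" for g :: "real \<Rightarrow> real"
    proof -
      interpret g: periodic_fun_simple g "2 * pi" by (fact that)
      show ?thesis
        using \<tau>3 g.plus_period g.minus_1
        by unfold_locales auto
    qed
    have "AE x in lborel. p * f x + (1 - p) * f (x - \<tau>) =
        p' * rot \<delta> f' x + (1 - p') * rot \<delta> f' (x + \<tau>)"
      using rel' unfolding rf[OF d] rf'[OF u1] rf'[OF u2] by (simp add: rot_def algebra_simps)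
    moreover have "0 < p' ^ 3 + (1 - p') ^ 3"
      using p' by (intro add_pos_pos) auto
    ultimately obtain k1 k2 k3 where
      "AE x in lborel. rot \<delta> f' x = k1 * f (x - \<tau>) + k2 * f (x + \<tau>) + k3 * f x"
      using three_point_deconvolution[of f \<tau> "rot \<delta> f'" p' "1 - p'" p "1 - p"]
        per3[OF f(1)] per3[OF periodic_rot[OF f'(1)]] by force
    \<comment> \<open>Undoing the shift by \<delta> determines the spanning functions: rotations of
      \<open>f\<close> by 0 and 2 pi / 3 up to sign when \<delta> = 0, by pi and pi / 3 up to sign
      when \<delta> = pi.\<close>
    from AE_lborel_shift[OF this, of "- \<delta>"]
    have comb: "ae_eq f' (\<lambda>x. k1 * rot (\<tau> - \<delta>) f x + k2 * rot (- \<tau> - \<delta>) f x + k3 * rot (- \<delta>) f x)"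
      by (simp add: ae_eq_def rot_def algebra_simps)
    \<comment> \<open>The two orientations exclude each other, so in each case one of the two
      implications of the goal is vacuous.\<close>
    have "\<not> [2 * pi / 3 = - (2 * pi / 3)] (rmod 2 * pi)"
      using rcong_imp_eq[of "2 * pi / 3" "- (2 * pi / 3)" "2 * pi"] by auto
    then have excl: "\<not> ([\<beta> - \<alpha> = 2 * pi / 3] (rmod 2 * pi) \<and> [\<beta> - \<alpha> = - (2 * pi / 3)] (rmod 2 * pi))"
      using rcong_sym rcong_trans by blast
    have rots: "rot (- (5 * pi / 3)) f = rot (pi / 3) f" "rot (- pi) f = rot pi f"
      by (rule rf, rule rcongI[of _ _ 1], simp)+
    have b5: "[\<beta>' = \<beta> - pi / 3] (rmod 2 * pi)" if "[\<beta>' = \<beta> + 5 * pi / 3] (rmod 2 * pi)"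
      using that by (rule rcong_trans) (rule rcongI[of _ _ "- 1"], simp)
    consider "\<tau> = 2 * pi / 3" "\<delta> = 0" | "\<tau> = 2 * pi / 3" "\<delta> = pi"
      | "\<tau> = - (2 * pi / 3)" "\<delta> = 0" | "\<tau> = - (2 * pi / 3)" "\<delta> = pi"
      using \<tau> \<delta> by auto
    then show ?thesis
    proof cases
      case 1
      have "\<exists>a b c. ae_eq f' (\<lambda>x. a * rot (2 * pi / 3) f x + b * rot (- (2 * pi / 3)) f x + c * f x)"
        by (rule exI[of _ k1], rule exI[of _ k2], rule exI[of _ k3])
           (use comb in \<open>simp add: 1 rot_def add_ac\<close>)
      moreover have "[\<alpha>' = \<alpha>] (rmod 2 * pi)" "[\<beta>' = \<beta> + 2 * pi / 3] (rmod 2 * pi)"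
        using a b by (simp_all add: 1)
      moreover have "[\<beta> - \<alpha> = 2 * pi / 3] (rmod 2 * pi)"
        using d unfolding 1 .
      ultimately show ?thesis
        using p'_eq excl by blast
    next
      case 2
      have "\<exists>a b c. ae_eq f' (\<lambda>x. a * rot (pi / 3) f x + b * rot (- (pi / 3)) f x + c * rot pi f x)"
        \<comment> \<open>The coefficients swap: subtracting pi from 2 pi / 3 gives -pi / 3, and
          from -2 pi / 3 gives -5 pi / 3, the same angle as pi / 3.\<close>
        by (rule exI[of _ k2], rule exI[of _ k1], rule exI[of _ k3])
           (use comb in \<open>simp add: 2 rots add_ac\<close>)
      moreover have "[\<alpha>' = \<alpha> + pi] (rmod 2 * pi)" "[\<beta>' = \<beta> - pi / 3] (rmod 2 * pi)"
        using a b b5 by (simp_all add: 2)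
      moreover have "[\<beta> - \<alpha> = 2 * pi / 3] (rmod 2 * pi)"
        using d unfolding 2 .
      ultimately show ?thesis
        using p'_eq excl by blast
    next
      case 3
      have "\<exists>a b c. ae_eq f' (\<lambda>x. a * rot (2 * pi / 3) f x + b * rot (- (2 * pi / 3)) f x + c * f x)"
        by (rule exI[of _ k2], rule exI[of _ k1], rule exI[of _ k3])
           (use comb in \<open>simp add: 3 rot_def add_ac\<close>)
      moreover have "[\<alpha>' = \<alpha>] (rmod 2 * pi)" "[\<beta>' = \<beta> - 2 * pi / 3] (rmod 2 * pi)"
        using a b by (simp_all add: 3)
      moreover have "[\<beta> - \<alpha> = - (2 * pi / 3)] (rmod 2 * pi)"
        using d unfolding 3 .
      ultimately show ?thesis
        using p'_eq excl by blast
    next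
      case 4
      have "\<exists>a b c. ae_eq f' (\<lambda>x. a * rot (pi / 3) f x + b * rot (- (pi / 3)) f x + c * rot pi f x)"
        by (rule exI[of _ k1], rule exI[of _ k2], rule exI[of _ k3])
           (use comb in \<open>simp add: 4 rots add_ac\<close>)
      moreover have "[\<alpha>' = \<alpha> + pi] (rmod 2 * pi)" "[\<beta>' = \<beta> + pi / 3] (rmod 2 * pi)"
        using a b by (simp_all add: 4)
      moreover have "[\<beta> - \<alpha> = - (2 * pi / 3)] (rmod 2 * pi)"
        using d unfolding 4 .
      ultimately show ?thesis
        using p'_eq excl by blast
    qed
  qed
qed

end
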